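(* Let $\beta$ be a unit-speed timelike curve in $\mathbb{E}^4_1$ with Frenet frame $\{F_1,F_2,F_3,F_4\}$ and first curvature $k_1$, let $r>0$ be constant, and let $M$ be the tubular hypersurface $$\mathcal{T}(s,t,w)=\beta(s)+r(\cos t\cos w\,F_2(s)+\sin t\cos w\,F_3(s)+\sin w\,F_4(s))$$ in $\mathbb{E}^4_1$, with Gauss map $N=-(\cos t\cos w\,F_2+\sin t\cos w\,F_3+\sin w\,F_4)$. Then $M$ has $\mathcal{L}_2$-harmonic Gauss map, i.e. $\mathcal{L}_2N=0$ on $M$, if and only if $k_1=0$ (identically).
   Context: $\mathbb{E}^4_1$ is $\mathbb{R}^4$ with the metric $\langle\ ,\ \rangle=-dx_1^2+dx_2^2+dx_3^2+dx_4^2$. The curve $\beta:I\to\mathbb{E}^4_1$ ($I$ an open interval) is smooth with $\beta'=F_1$, and $\{F_1,F_2,F_3,F_4\}$ is a smooth orthonormal frame along $\beta$ with $\langle F_1,F_1\rangle=-1$, $\langle F_i,F_i\rangle=1$ ($i=2,3,4$), satisfying the Frenet equations $F_1'=k_1F_2$, $F_2'=k_1F_1+k_2F_3$, $F_3'=-k_2F_2+k_3F_4$, $F_4'=-k_3F_3$, where $k_1,k_2,k_3$ are smooth functions of $s$ (the curvatures of $\beta$; they are allowed to vanish). The parameters $(s,t,w)$ range over a connected open set $U\subset I\times\mathbb{R}^2$ projecting onto $I$ on which $\mathcal{T}$ is an immersion, i.e. $\cos w\neq0$ and $1+rk_1\cos t\cos w\neq0$. The unit normal $N$ has $\varepsilon=\langle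 N,N\rangle=1$, and the principal curvatures with respect to $N$ (eigenvalues of the shape operator $-dN$) are $\kappa_1=\kappa_2=\frac1r$, $\kappa_3=\frac{k_1\cos t\cos w}{1+rk_1\cos t\cos w}$. Operator $\mathcal{L}_2$ on the Gauss map: put $a_1=-\sum_i\kappa_i$, $a_k=(-1)^k\sum_{i_1<\dots<i_k}\kappa_{i_1}\cdots\kappa_{i_k}$ ($k=2,3$), and define $H_k$ by $\binom{3}{k}H_k=(-\varepsilon)^ka_k$. Then $$\mathcal{L}_2N=-\varepsilon\,\mathfrak{C}_2\big(\nabla H_3+3H_1H_3\,N\big),\qquad \mathfrak{C}_2=\binom33(-\varepsilon)^2=1,$$ where $\nabla$ is the gradient on $M$ with respect to the induced metric, viewed as an $\mathbb{E}^4_1$-valued map. *)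

theory Defs
  imports "HOL-Analysis.Analysis" "HOL-Computational_Algebra.Polynomial"
begin

definition mink :: "real^4 \<Rightarrow> real^4 \<Rightarrow> real" where
  "mink x y = - (x$1 * y$1) + x$2 * y$2 + x$3 * y$3 + x$4 * y$4"

definition smooth_curve_on :: "real set \<Rightarrow> (real \<Rightarrow> 'a::real_normed_vector) \<Rightarrow> bool" where
  "smooth_curve_on I f \<longleftrightarrow>
     (\<exists>D. D 0 = f \<and> (\<forall>n. \<forall>s\<in>I. (D n has_vector_derivative D (Suc n) s) (at s)))"

definition timelike_frenet_curve ::
  "real set \<Rightarrow> (real \<Rightarrow> real^4) \<Rightarrow> (4 \<Rightarrow> real \<Rightarrow> real^4) \<Rightarrow>
     (real \<Rightarrow> real) \<Rightarrow> (real \<Rightarrow> real) \<Rightarrow> (real \<Rightarrow> real) \<Rightarrow> bool" where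
  "timelike_frenet_curve I \<beta> F k1 k2 k3 \<longleftrightarrow>
     smooth_curve_on I \<beta> \<and> (\<forall>i. smooth_curve_on I (F i)) \<and>
     smooth_curve_on I k1 \<and> smooth_curve_on I k2 \<and> smooth_curve_on I k3 \<and>
     (\<forall>s\<in>I. \<forall>i j. mink (F i s) (F j s) = (if i \<noteq> j then 0 else if i = 1 then -1 else 1)) \<and>
     (\<forall>s\<in>I.
        (\<beta> has_vector_derivative F 1 s) (at s) \<and>
        (F 1 has_vector_derivative k1 s *\<^sub>R F 2 s) (at s) \<and>
        (F 2 has_vector_derivative k1 s *\<^sub>R F 1 s + k2 s *\<^sub>R F 3 s) (at s) \<and>
        (F 3 has_vector_derivative - k2 s *\<^sub>R F 2 s + k3 s *\<^sub>R F 4 s) (at s) \<and>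
        (F 4 has_vector_derivative - k3 s *\<^sub>R F 3 s) (at s))"

text \<open>
  A hypersurface is given by a parametrization \<open>X\<close> of (an open part of) \<open>real^3\<close> together with
  a unit normal field \<open>N\<close>, both functions of the parameter. Tangent vectors are represented by
  their preimages under the (injective) derivative of \<open>X\<close>.
\<close>

definition immersion_on :: "(real^3 \<Rightarrow> real^4) \<Rightarrow> (real^3) set \<Rightarrow> bool" where
  "immersion_on X U \<longleftrightarrow>
     (\<forall>p\<in>U. X differentiable (at p) \<and> inj (frechet_derivative X (at p)))"

definition shape_operator ::
  "(real^3 \<Rightarrow> real^4) \<Rightarrow> (real^3 \<Rightarrow> real^4) \<Rightarrow> real^3 \<Rightarrow> real^3 \<Rightarrow> real^3" where
  "shape_operator X N p =
     (THE S. linear S \<and>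
        (\<forall>v. frechet_derivative X (at p) (S v) = - frechet_derivative N (at p) v))"

definition char_polynomial :: "real^'n^'n \<Rightarrow> real poly" where
  "char_polynomial A = det (\<chi> i j. (if i = j then [:0, 1:] else 0) - [:A$i$j:])"

text \<open>
  The real eigenvalues of the shape operator, repeated according to algebraic multiplicity.
  The list has length 3 exactly when the characteristic polynomial splits over the reals;
  for an indefinite induced metric this is not automatic, but it holds for tubular hypersurfaces.
\<close>

definition principal_curvatures ::
  "(real^3 \<Rightarrow> real^4) \<Rightarrow> (real^3 \<Rightarrow> real^4) \<Rightarrow> real^3 \<Rightarrow> real list" where
  "principal_curvatures X N p =
     sorted_list_of_multiset (proots (char_polynomial (matrix (shape_operator X N p))))"

definition curv_coeff ::
  "(real^3 \<Rightarrow> real^4) \<Rightarrow> (real^3 \<Rightarrow> real^4) \<Rightarrow> nat \<Rightarrow> real^3 \<Rightarrow> real" where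
  "curv_coeff X N k p =
     (let \<kappa> = principal_curvatures X N p
      in (-1)^k * (\<Sum>J | J \<subseteq> {..<length \<kappa>} \<and> card J = k. \<Prod>i\<in>J. \<kappa> ! i))"

definition mean_curv ::
  "(real^3 \<Rightarrow> real^4) \<Rightarrow> (real^3 \<Rightarrow> real^4) \<Rightarrow> nat \<Rightarrow> real^3 \<Rightarrow> real" where
  "mean_curv X N k p = (- mink (N p) (N p))^k * curv_coeff X N k p / real (3 choose k)"

text \<open>The gradient for the metric induced by \<open>X\<close>, as a vector of the ambient space.\<close>

definition induced_gradient ::
  "(real^3 \<Rightarrow> real^4) \<Rightarrow> (real^3 \<Rightarrow> real) \<Rightarrow> real^3 \<Rightarrow> real^4" where
  "induced_gradient X f p =
     frechet_derivative X (at p)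
       (THE v. \<forall>u. mink (frechet_derivative X (at p) v) (frechet_derivative X (at p) u)
                    = frechet_derivative f (at p) u)"

text \<open>
  The value of the operator \<open>L\<^sub>2\<close> on the Gauss map \<open>N\<close>, given by the formula
  \<open>L\<^sub>2 N = - \<epsilon> C\<^sub>2 (\<nabla> H\<^sub>3 + 3 H\<^sub>1 H\<^sub>3 N)\<close> with \<open>\<epsilon> = \<langle>N, N\<rangle>\<close> and \<open>C\<^sub>2 = (3 choose 3) (-\<epsilon>)\<^sup>2\<close>.
\<close>

definition L2_gauss ::
  "(real^3 \<Rightarrow> real^4) \<Rightarrow> (real^3 \<Rightarrow> real^4) \<Rightarrow> real^3 \<Rightarrow> real^4" where
  "L2_gauss X N p =
     (let \<epsilon> = mink (N p) (N p); C2 = real (3 choose 3) * (- \<epsilon>)^2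
      in (- \<epsilon> * C2) *\<^sub>R
           (induced_gradient X (mean_curv X N 3) p
            + (3 * mean_curv X N 1 p * mean_curv X N 3 p) *\<^sub>R N p))"

text \<open>In the following the parameter \<open>p\<close> is \<open>(s, t, w)\<close>.\<close>

definition tube_normal :: "(4 \<Rightarrow> real \<Rightarrow> real^4) \<Rightarrow> real^3 \<Rightarrow> real^4" where
  "tube_normal F p =
     - ((cos (p$2) * cos (p$3)) *\<^sub>R F 2 (p$1) + (sin (p$2) * cos (p$3)) *\<^sub>R F 3 (p$1)
        + sin (p$3) *\<^sub>R F 4 (p$1))"

definition tube :: "(real \<Rightarrow> real^4) \<Rightarrow> (4 \<Rightarrow> real \<Rightarrow> real^4) \<Rightarrow> real \<Rightarrow> real^3 \<Rightarrow> real^4" where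
  "tube \<beta> F r p =
     \<beta> (p$1) + r *\<^sub>R ((cos (p$2) * cos (p$3)) *\<^sub>R F 2 (p$1)
        + (sin (p$2) * cos (p$3)) *\<^sub>R F 3 (p$1) + sin (p$3) *\<^sub>R F 4 (p$1))"

end

theory Submission imports Defs begin

text \<open>
  With \<open>\<alpha> = \<kappa>\<^sub>3\<close> one has \<open>3 H\<^sub>1 = \<alpha> + 2/r\<close> and \<open>H\<^sub>3 = \<alpha>/r\<^sup>2\<close>. The gradient \<open>\<nabla>H\<^sub>3\<close> is tangent to the
  tube, so \<open>L\<^sub>2 N = 0\<close> forces \<open>H\<^sub>1 H\<^sub>3 = 0\<close>, that is, \<open>k\<^sub>1 cos t cos w\<close> is \<open>0\<close> or \<open>- 2/(3r)\<close>. If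
  \<open>k\<^sub>1(s) \<noteq> 0\<close>, moving \<open>t\<close> alone would make \<open>cos\<close> take finitely many values on an open set of angles,
  which is absurd. Conversely \<open>k\<^sub>1 = 0\<close> gives \<open>H\<^sub>3 = 0\<close>, and then \<open>\<nabla>H\<^sub>3 = 0\<close> because the induced
  metric is nondegenerate.
\<close>

subsection \<open>The Minkowski form\<close>

lemma mink_add_left: "mink (x + y) z = mink x z + mink y z"
  and mink_add_right: "mink z (x + y) = mink z x + mink z y"
  and mink_diff_left: "mink (x - y) z = mink x z - mink y z"
  and mink_diff_right: "mink z (x - y) = mink z x - mink z y"
  and mink_minus_left: "mink (- x) z = - mink x z"
  and mink_minus_right: "mink z (- x) = - mink z x"
  and mink_scaleR_left: "mink (c *\<^sub>R x) z = c * mink x z"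
  and mink_scaleR_right: "mink z (c *\<^sub>R x) = c * mink z x"
  and mink_zero_left: "mink 0 z = 0"
  and mink_zero_right: "mink z 0 = 0"
  by (simp_all add: mink_def algebra_simps)

lemmas mink_simps = mink_add_left mink_add_right mink_diff_left mink_diff_right
  mink_minus_left mink_minus_right mink_scaleR_left mink_scaleR_right mink_zero_left mink_zero_right

subsection \<open>Symmetric functions of the principal curvatures\<close>

lemma sum_card_1_subsets:
  fixes xs :: "'a::comm_semiring_1 list"
  shows "(\<Sum>J | J \<subseteq> {..<length xs} \<and> card J = 1. \<Prod>i\<in>J. xs ! i) = sum_list xs"
proof -
  have "{J. J \<subseteq> {..<length xs} \<and> card J = 1} = (\<lambda>i. {i}) ` {..<length xs}"
    by (auto simp: card_1_singleton_iff)
  then show ?thesis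
    by (simp add: sum.reindex sum_list_sum_nth atLeast0LessThan)
qed

lemma sum_full_card_subsets:
  fixes xs :: "'a::comm_semiring_1 list"
  shows "(\<Sum>J | J \<subseteq> {..<length xs} \<and> card J = length xs. \<Prod>i\<in>J. xs ! i) = prod_list xs"
proof -
  have "{J. J \<subseteq> {..<length xs} \<and> card J = length xs} = {{..<length xs}}"
    by (auto dest: card_subset_eq[rotated])
  then show ?thesis
    by (simp add: prod.list_conv_set_nth atLeast0LessThan)
qed

lemma char_polynomial_lower_triangular:
  fixes A :: "real^3^3"
  assumes "A$1$2 = 0" "A$1$3 = 0" "A$2$3 = 0"
  shows "char_polynomial A = [:- A$1$1, 1:] * [:- A$2$2, 1:] * [:- A$3$3, 1:]"
  using assms by (simp add: char_polynomial_def det_3)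

lemma proots_three_linear_factors:
  fixes a b c :: real
  shows "proots ([:- a, 1:] * [:- b, 1:] * [:- c, 1:]) = {#a, b, c#}"
proof -
  have "[:- a, 1:] * [:- b, 1:] \<noteq> 0" "[:- c, 1:] \<noteq> 0" "[:- a, 1:] \<noteq> 0" "[:- b, 1:] \<noteq> 0"
    by auto
  then show ?thesis
    by (simp add: proots_mult del: mult_pCons_left mult_pCons_right)
qed

text \<open>The sorted order of the list depends on the sizes of a, b, c. The
  \<open>mean_curv\<close> values are symmetric functions, so only the multiset needs to be
  tracked.\<close>

lemma mset_principal_curvatures:
  assumes "char_polynomial (matrix (shape_operator X N p)) = [:- a, 1:] * [:- b, 1:] * [:- c, 1:]"
  shows "mset (principal_curvatures X N p) = {#a, b, c#}"
  unfolding principal_curvatures_def assms proots_three_linear_factors by simp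

lemma mean_curv_1:
  assumes "mset (principal_curvatures X N p) = {#a, b, c#}" and "mink (N p) (N p) = 1"
  shows "mean_curv X N 1 p = (a + b + c) / 3"
  using assms sum_mset_sum_list[of "principal_curvatures X N p"]
  by (simp add: mean_curv_def curv_coeff_def Let_def sum_card_1_subsets[simplified] add.assoc)

lemma mean_curv_3:
  assumes "mset (principal_curvatures X N p) = {#a, b, c#}" and "mink (N p) (N p) = 1"
  shows "mean_curv X N 3 p = a * b * c"
proof -
  have "length (principal_curvatures X N p) = 3"
    using arg_cong[OF assms(1), of size] by simp
  then show ?thesis
    using assms sum_full_card_subsets[of "principal_curvatures X N p"]
      prod_mset_prod_list[of "principal_curvatures X N p"]
    by (simp add: mean_curv_def curv_coeff_def Let_def mult.assoc)
qed

subsection \<open>An adapted frame along the tube\<close>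

lemma has_derivative_curve_component:
  assumes "(f has_vector_derivative f') (at (p$i))"
  shows "((\<lambda>p::real^'n. f (p$i)) has_derivative (\<lambda>v. v$i *\<^sub>R f')) (at p)"
proof -
  have "((\<lambda>p::real^'n. p$i) has_derivative (\<lambda>v. v$i)) (at p)"
    by (rule bounded_linear_imp_has_derivative) (rule bounded_linear_vec_nth)
  from has_derivative_compose[OF this assms[unfolded has_vector_derivative_def]]
  show ?thesis by simp
qed

text \<open>Injectivity of dX leaves at most one solution, so exhibiting a linear one settles the
  definite description.\<close>

lemma shape_operator_eqI:
  assumes "inj (frechet_derivative X (at p))" and "linear S"
    and "\<And>v. frechet_derivative X (at p) (S v) = - frechet_derivative N (at p) v"
  shows "shape_operator X N p = S"
  unfolding shape_operator_def
proof (rule the_equality)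
  fix S' assume "linear S' \<and> (\<forall>v. frechet_derivative X (at p) (S' v) = - frechet_derivative N (at p) v)"
  then show "S' = S"
    using assms by (metis ext injD)
qed (use assms in auto)

locale frenet_tube =
  fixes I :: "real set" and \<beta> :: "real \<Rightarrow> real^4" and F :: "4 \<Rightarrow> real \<Rightarrow> real^4"
    and k1 k2 k3 :: "real \<Rightarrow> real" and r :: real
  assumes frenet: "timelike_frenet_curve I \<beta> F k1 k2 k3" and r_pos: "r > 0"
begin

text \<open>The vectors \<open>F\<^sub>1, e\<^sub>2, e\<^sub>3\<close> are an orthonormal basis of the tangent space of the tube; \<open>\<mu> p * v$1\<close>,
  \<open>a2 p v\<close> and \<open>a3 p v\<close> are the coordinates of \<open>- dN v\<close> in it.\<close>

definition e2 :: "real^3 \<Rightarrow> real^4" where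
  "e2 p = - sin (p$2) *\<^sub>R F 2 (p$1) + cos (p$2) *\<^sub>R F 3 (p$1)"

definition e3 :: "real^3 \<Rightarrow> real^4" where
  "e3 p = - (cos (p$2) * sin (p$3)) *\<^sub>R F 2 (p$1) - (sin (p$2) * sin (p$3)) *\<^sub>R F 3 (p$1)
     + cos (p$3) *\<^sub>R F 4 (p$1)"

definition \<mu> :: "real^3 \<Rightarrow> real" where
  "\<mu> p = k1 (p$1) * cos (p$2) * cos (p$3)"

definition a2 :: "real^3 \<Rightarrow> real^3 \<Rightarrow> real" where
  "a2 p v = (k2 (p$1) * cos (p$3) - k3 (p$1) * cos (p$2) * sin (p$3)) * v$1 + cos (p$3) * v$2"

definition a3 :: "real^3 \<Rightarrow> real^3 \<Rightarrow> real" where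
  "a3 p v = k3 (p$1) * sin (p$2) * v$1 + v$3"

lemma mink_frame:
  assumes "p$1 \<in> I"
  shows "mink (F i (p$1)) (F j (p$1)) = (if i \<noteq> j then 0 else if i = 1 then -1 else 1)"
  using frenet assms unfolding timelike_frenet_curve_def by blast

lemma adapted_frame_orthonormal:
  assumes "p$1 \<in> I"
  shows "mink (F 1 (p$1)) (F 1 (p$1)) = -1" "mink (e2 p) (e2 p) = 1" "mink (e3 p) (e3 p) = 1"
    and "mink (tube_normal F p) (tube_normal F p) = 1"
    and "mink (F 1 (p$1)) (e2 p) = 0" "mink (e2 p) (F 1 (p$1)) = 0"
    and "mink (F 1 (p$1)) (e3 p) = 0" "mink (e3 p) (F 1 (p$1)) = 0"
    and "mink (e2 p) (e3 p) = 0" "mink (e3 p) (e2 p) = 0"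
    and "mink (F 1 (p$1)) (tube_normal F p) = 0" "mink (e2 p) (tube_normal F p) = 0"
    and "mink (e3 p) (tube_normal F p) = 0"
proof -
  note [simp] = mink_simps mink_frame[OF assms] e2_def e3_def tube_normal_def
  have *: "sin (p$2) * sin (p$2) = 1 - cos (p$2) * cos (p$2)"
    "sin (p$3) * sin (p$3) = 1 - cos (p$3) * cos (p$3)"
    using sin_squared_eq by (simp_all add: power2_eq_square)
  show "mink (F 1 (p$1)) (F 1 (p$1)) = -1"
    "mink (F 1 (p$1)) (e2 p) = 0" "mink (e2 p) (F 1 (p$1)) = 0"
    "mink (F 1 (p$1)) (e3 p) = 0" "mink (e3 p) (F 1 (p$1)) = 0"
    "mink (F 1 (p$1)) (tube_normal F p) = 0"
    by simp_all
  show "mink (e2 p) (e2 p) = 1" "mink (e3 p) (e3 p) = 1"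
    "mink (tube_normal F p) (tube_normal F p) = 1"
    "mink (e2 p) (e3 p) = 0" "mink (e3 p) (e2 p) = 0"
    "mink (e2 p) (tube_normal F p) = 0" "mink (e3 p) (tube_normal F p) = 0"
    using * by (simp_all, algebra+)
qed

section \<open>Derivatives of the normal and of the tube\<close>

lemma has_derivative_tube_normal:
  assumes "p$1 \<in> I"
  shows "(tube_normal F has_derivative
    (\<lambda>v. - ((\<mu> p * v$1) *\<^sub>R F 1 (p$1) + a2 p v *\<^sub>R e2 p + a3 p v *\<^sub>R e3 p))) (at p)"
proof -
  define s t w where "s = p$1" and "t = p$2" and "w = p$3"
  have nth: "((\<lambda>p. p$i) has_derivative (\<lambda>v. v$i)) (at p)" for i :: 3
    by (rule bounded_linear_imp_has_derivative) (rule bounded_linear_vec_nth)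
  have F: "(F 2 has_vector_derivative k1 s *\<^sub>R F 1 s + k2 s *\<^sub>R F 3 s) (at s)"
    "(F 3 has_vector_derivative - k2 s *\<^sub>R F 2 s + k3 s *\<^sub>R F 4 s) (at s)"
    "(F 4 has_vector_derivative - k3 s *\<^sub>R F 3 s) (at s)"
    using frenet assms unfolding timelike_frenet_curve_def s_def by blast+
  note D = F[unfolded s_def, THEN has_derivative_curve_component]
  have "(tube_normal F has_derivative (\<lambda>v. - (
      (cos t * cos w) *\<^sub>R v$1 *\<^sub>R (k1 s *\<^sub>R F 1 s + k2 s *\<^sub>R F 3 s)
      + (- (sin t * cos w * v$2) - cos t * sin w * v$3) *\<^sub>R F 2 s
      + (sin t * cos w) *\<^sub>R v$1 *\<^sub>R (- k2 s *\<^sub>R F 2 s + k3 s *\<^sub>R F 4 s)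
      + (cos t * cos w * v$2 - sin t * sin w * v$3) *\<^sub>R F 3 s
      + sin w *\<^sub>R v$1 *\<^sub>R (- k3 s *\<^sub>R F 3 s)
      + (cos w * v$3) *\<^sub>R F 4 s))) (at p)"
    unfolding tube_normal_def[abs_def]
    by (rule derivative_eq_intros D nth refl)+
      (auto simp: fun_eq_iff s_def t_def w_def algebra_simps)
  \<comment> \<open>The product rule's output is regrouped along \<open>F 1\<close>,
    \<open>e2\<close>, \<open>e3\<close>. Comparing coefficients of the Frenet frame, the relation
    sin^2 t + cos^2 t = 1 enters only in the k3 term at \<open>F 3\<close>.\<close>
  moreover have "(cos t * cos w) *\<^sub>R x *\<^sub>R (k1 s *\<^sub>R F 1 s + k2 s *\<^sub>R F 3 s)
      + (- (sin t * cos w * y) - cos t * sin w * z) *\<^sub>R F 2 s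
      + (sin t * cos w) *\<^sub>R x *\<^sub>R (- k2 s *\<^sub>R F 2 s + k3 s *\<^sub>R F 4 s)
      + (cos t * cos w * y - sin t * sin w * z) *\<^sub>R F 3 s
      + sin w *\<^sub>R x *\<^sub>R (- k3 s *\<^sub>R F 3 s)
      + (cos w * z) *\<^sub>R F 4 s
    = (k1 s * cos t * cos w * x) *\<^sub>R F 1 s
      + ((k2 s * cos w - k3 s * cos t * sin w) * x + cos w * y) *\<^sub>R
          (- sin t *\<^sub>R F 2 s + cos t *\<^sub>R F 3 s)
      + (k3 s * sin t * x + z) *\<^sub>R
          (- (cos t * sin w) *\<^sub>R F 2 s - (sin t * sin w) *\<^sub>R F 3 s + cos w *\<^sub>R F 4 s)"
    for x y z
  proof -
    have "sin t * sin t + cos t * cos t = 1"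
      using sin_cos_squared_add3 by (simp add: add.commute)
    then show ?thesis
      unfolding vec_eq_iff by (simp, algebra)
  qed
  ultimately show ?thesis
    unfolding e2_def e3_def a2_def a3_def \<mu>_def s_def t_def w_def by (simp only:)
qed

text \<open>Hence dX = ds F_1 - r dN, so the derivative of the tube is read off from that of the
  normal.\<close>

lemma tube_eq: "tube \<beta> F r p = \<beta> (p$1) - r *\<^sub>R tube_normal F p"
  by (simp only: tube_def tube_normal_def scaleR_minus_right diff_minus_eq_add)

lemma has_derivative_tube:
  assumes "p$1 \<in> I"
  shows "(tube \<beta> F r has_derivative
    (\<lambda>v. ((1 + r * \<mu> p) * v$1) *\<^sub>R F 1 (p$1) + (r * a2 p v) *\<^sub>R e2 p + (r * a3 p v) *\<^sub>R e3 p)) (at p)"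
proof -
  have "(\<beta> has_vector_derivative F 1 (p$1)) (at (p$1))"
    using frenet assms unfolding timelike_frenet_curve_def by blast
  note * = has_derivative_curve_component[OF this] has_derivative_tube_normal[OF assms]
  show ?thesis
    unfolding tube_eq[abs_def]
    by (rule derivative_eq_intros * refl)+ (simp add: fun_eq_iff algebra_simps)
qed

lemmas frechet_tube = frechet_derivative_at[OF has_derivative_tube, symmetric]
lemmas frechet_tube_normal = frechet_derivative_at[OF has_derivative_tube_normal, symmetric]

text \<open>If either quantity vanished, dX would have an explicit nonzero kernel vector; for cos w
  = 0 it is the t-direction.\<close>

lemma immersion_nondegenerate:
  assumes "p$1 \<in> I" and "inj (frechet_derivative (tube \<beta> F r) (at p))"
  shows "cos (p$3) \<noteq> 0" and "1 + r * \<mu> p \<noteq> 0"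
proof -
  let ?D = "frechet_derivative (tube \<beta> F r) (at p)"
  have inj: "v = 0" if "?D v = 0" for v
  proof (rule injD[OF assms(2)])
    show "?D v = ?D 0" using that by (simp add: frechet_tube[OF assms(1)] a2_def a3_def)
  qed
  show c: "cos (p$3) \<noteq> 0"
  proof
    assume "cos (p$3) = 0"
    then have "?D (axis 2 1) = 0"
      by (simp add: frechet_tube[OF assms(1)] a2_def a3_def axis_def)
    from inj[OF this] show False by (simp add: axis_eq_0_iff)
  qed
  show "1 + r * \<mu> p \<noteq> 0"
  proof
    assume *: "1 + r * \<mu> p = 0"
    define A where "A = k2 (p$1) * cos (p$3) - k3 (p$1) * cos (p$2) * sin (p$3)"
    \<comment> \<open>Solves \<open>a2 p v = 0\<close> and \<open>a3 p v = 0\<close>, scaled by cos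
      w to avoid a division. The \<open>F 1\<close> coefficient vanishes by assumption, while
      \<open>v$1\<close> = cos w is nonzero.\<close>
    define v :: "real^3" where "v = vector [cos (p$3), - A, - (k3 (p$1) * sin (p$2) * cos (p$3))]"
    have "?D v = 0"
      by (simp add: frechet_tube[OF assms(1)] a2_def a3_def v_def * A_def[symmetric])
    from inj[OF this] have "v$1 = 0" by simp
    with c show False by (simp add: v_def)
  qed
qed

section \<open>Principal and mean curvatures of the tube\<close>

definition \<alpha> :: "real^3 \<Rightarrow> real" where
  "\<alpha> p = \<mu> p / (1 + r * \<mu> p)"

text \<open>In the basis \<open>F 1\<close>, \<open>e2\<close>, \<open>e3\<close>, dX has
  coordinates (1 + r \<mu>) v_1, r a2, r a3 and -dN has \<mu> v_1, a2, a3. Comparing them determines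
  the components of S v one after another. The factor 1 - \<alpha> r appears because a2 and a3 also
  involve the first component.\<close>

lemma mset_principal_curvatures_tube:
  assumes "p$1 \<in> I" and "inj (frechet_derivative (tube \<beta> F r) (at p))"
  shows "mset (principal_curvatures (tube \<beta> F r) (tube_normal F) p) = {#\<alpha> p, 1/r, 1/r#}"
proof -
  note nz = immersion_nondegenerate[OF assms]
  define A B where "A = k2 (p$1) * cos (p$3) - k3 (p$1) * cos (p$2) * sin (p$3)"
    and "B = k3 (p$1) * sin (p$2)"
  \<comment> \<open>the solution of \<open>dX (S v) = - dN v\<close>; its matrix is lower triangular\<close>
  define S :: "real^3 \<Rightarrow> real^3" where
    "S v = vector [\<alpha> p * v$1, A * (1 - \<alpha> p * r) / (r * cos (p$3)) * v$1 + 1/r * v$2,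
       B * (1 - \<alpha> p * r) / r * v$1 + 1/r * v$3]" for v
  have lin: "linear S"
    by (rule linearI) (simp_all add: S_def vec_eq_iff forall_3 distrib_left mult.left_commute add_divide_distrib)
  have S: "shape_operator (tube \<beta> F r) (tube_normal F) p = S"
  proof (rule shape_operator_eqI[OF assms(2) lin])
    fix v :: "real^3"
    have "(1 + r * \<mu> p) * (\<alpha> p * v$1) = \<mu> p * v$1"
      using nz by (simp add: \<alpha>_def)
    moreover have "r * a2 p (S v) = a2 p v" "r * a3 p (S v) = a3 p v"
      using nz r_pos by (simp_all add: a2_def a3_def S_def A_def B_def field_simps)
    ultimately show "frechet_derivative (tube \<beta> F r) (at p) (S v)
        = - frechet_derivative (tube_normal F) (at p) v"
      by (simp add: frechet_tube[OF assms(1)] frechet_tube_normal[OF assms(1)] S_def)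
  qed
  let ?M = "matrix S"
  have "?M$1$1 = \<alpha> p" "?M$2$2 = 1/r" "?M$3$3 = 1/r" "?M$1$2 = 0" "?M$1$3 = 0" "?M$2$3 = 0"
    by (simp_all add: matrix_def S_def axis_def)
  then have "char_polynomial ?M = [:- \<alpha> p, 1:] * [:- (1/r), 1:] * [:- (1/r), 1:]"
    by (simp only: char_polynomial_lower_triangular)
  then show ?thesis
    by (intro mset_principal_curvatures) (simp only: S)
qed

lemma mean_curv_tube:
  assumes "p$1 \<in> I" and "inj (frechet_derivative (tube \<beta> F r) (at p))"
  shows "mean_curv (tube \<beta> F r) (tube_normal F) 1 p = (\<alpha> p + 2 / r) / 3"
    and "mean_curv (tube \<beta> F r) (tube_normal F) 3 p = \<alpha> p / r\<^sup>2"
  using mean_curv_1[OF mset_principal_curvatures_tube[OF assms] adapted_frame_orthonormal(4)[OF assms(1)]]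
    mean_curv_3[OF mset_principal_curvatures_tube[OF assms] adapted_frame_orthonormal(4)[OF assms(1)]]
  by (simp_all add: power2_eq_square)

section \<open>Consequences of the formula for the operator on the Gauss map\<close>

lemma L2_gauss_zero_imp:
  assumes "p$1 \<in> I" and "inj (frechet_derivative (tube \<beta> F r) (at p))"
    and "L2_gauss (tube \<beta> F r) (tube_normal F) p = 0"
  shows "\<mu> p = 0 \<or> \<mu> p = - 2 / (3 * r)"
proof -
  let ?H = "mean_curv (tube \<beta> F r) (tube_normal F)"
  \<comment> \<open>Whatever vector the description inside the gradient denotes, its image under dX
    is a combination of \<open>F 1\<close>, \<open>e2\<close>, \<open>e3\<close>, all orthogonal to
    the normal.\<close>
  have "mink (induced_gradient (tube \<beta> F r) (?H 3) p) (tube_normal F p) = 0"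
    by (simp add: induced_gradient_def frechet_tube[OF assms(1)] mink_simps
        adapted_frame_orthonormal[OF assms(1)])
  moreover have "induced_gradient (tube \<beta> F r) (?H 3) p + (3 * ?H 1 p * ?H 3 p) *\<^sub>R tube_normal F p = 0"
    using assms(3) by (simp add: L2_gauss_def Let_def adapted_frame_orthonormal[OF assms(1)]
        del: scaleR_minus_left minus_add_distrib One_nat_def)
  ultimately have "(3 * ?H 1 p * ?H 3 p) * mink (tube_normal F p) (tube_normal F p) = 0"
    by (metis add_0 mink_add_left mink_scaleR_left mink_zero_left)
  then have "?H 1 p * ?H 3 p = 0"
    by (simp add: adapted_frame_orthonormal[OF assms(1)])
  \<comment> \<open>The two cases are H_3 = 0 and H_1 = 0.\<close>
  then have "\<alpha> p = 0 \<or> \<alpha> p = - 2 / r"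
    using r_pos by (auto simp: mean_curv_tube[OF assms(1,2)] eq_neg_iff_add_eq_0 simp del: One_nat_def)
  then show ?thesis
    using immersion_nondegenerate(2)[OF assms(1,2)] r_pos by (auto simp: \<alpha>_def field_simps)
qed

text \<open>Here the description must be evaluated: it is 0 because only the zero vector is
  orthogonal to the whole tangent space.\<close>

lemma induced_gradient_zero:
  assumes "p$1 \<in> I" and "inj (frechet_derivative (tube \<beta> F r) (at p))"
    and "(f has_derivative (\<lambda>_. 0)) (at p)"
  shows "induced_gradient (tube \<beta> F r) f p = 0"
proof -
  note D = frechet_tube[OF assms(1)] and on = adapted_frame_orthonormal[OF assms(1)]
  let ?D = "frechet_derivative (tube \<beta> F r) (at p)"
  have f: "frechet_derivative f (at p) = (\<lambda>_. 0)"
    using frechet_derivative_at[OF assms(3)] by simp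
  have form: "mink (?D v) (?D u) = - ((1 + r * \<mu> p)\<^sup>2 * v$1 * u$1) + r\<^sup>2 * (a2 p v * a2 p u + a3 p v * a3 p u)"
    for u v by (simp add: D mink_simps on power2_eq_square algebra_simps)
  have "(THE v. \<forall>u. mink (?D v) (?D u) = 0) = 0"
  proof (rule the_equality)
    show "\<forall>u. mink (?D 0) (?D u) = 0" by (simp add: form a2_def a3_def)
  next
    fix v assume "\<forall>u. mink (?D v) (?D u) = 0"
    then have *: "mink (?D v) (?D u) = 0" for u by blast
    note nz = immersion_nondegenerate[OF assms(1,2)]
    \<comment> \<open>The t- and w-directions are tested first, since each isolates one of a2, a3.
      The s-direction involves both, and isolates \<open>v$1\<close> only once they vanish.\<close>
    have a2: "a2 p v = 0"
      using *[of "axis 2 1"] nz r_pos by (simp add: form a2_def[of p "axis _ _"] a3_def[of p "axis _ _"]) (simp add: axis_def)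
    have a3: "a3 p v = 0"
      using *[of "axis 3 1"] r_pos by (simp add: form a2_def[of p "axis _ _"] a3_def[of p "axis _ _"]) (simp add: axis_def)
    have v1: "v$1 = 0"
      using *[of "axis 1 1"] nz by (simp add: form a2 a3 axis_def)
    show "v = 0"
      using a2 a3 v1 nz by (simp add: a2_def a3_def vec_eq_iff forall_3)
  qed
  then show ?thesis by (simp add: induced_gradient_def f D a2_def a3_def)
qed

end

text \<open>A finite connected image of a ball is a single point, so cos would be constant there.
  Differentiating once gives sin = 0 on the ball, and differentiating again gives cos = 0 at its
  centre, contradicting sin^2 + cos^2 = 1.\<close>

lemma infinite_cos_image:
  fixes T :: "real set"
  assumes "open T" and "T \<noteq> {}"
  shows "infinite (cos ` T)"
proof
  assume fin: "finite (cos ` T)"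
  from assms obtain t where "t \<in> T" by blast
  with assms obtain e where e: "e > 0" "ball t e \<subseteq> T" by (meson openE)
  have "connected (cos ` ball t e)"
    by (intro connected_continuous_image continuous_intros) simp
  moreover have "finite (cos ` ball t e)" using fin e by (meson finite_subset image_mono)
  moreover have "cos ` ball t e \<noteq> {}" using e by simp
  ultimately obtain c where "cos ` ball t e = {c}" using connected_finite_iff_sing by metis
  then have c: "cos x = c" if "x \<in> ball t e" for x using that by blast
  have sin: "sin x = 0" if "x \<in> ball t e" for x
  proof -
    have "(cos has_real_derivative 0) (at x)"
      by (rule has_field_derivative_transform_within_open[of "\<lambda>_. c" _ _ "ball t e"])
        (use that c in auto)
    with DERIV_cos show ?thesis using DERIV_unique by fastforce
  qed
  have "(sin has_real_derivative 0) (at t)"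
    by (rule has_field_derivative_transform_within_open[of "\<lambda>_. 0" _ _ "ball t e"])
      (use sin e in auto)
  then have "cos t = 0" using DERIV_unique DERIV_sin by blast
  with sin[of t] e show False using sin_cos_squared_add[of t] by simp
qed

theorem theorem8:
  fixes I :: "real set" and \<beta> :: "real \<Rightarrow> real^4" and F :: "4 \<Rightarrow> real \<Rightarrow> real^4"
    and k1 k2 k3 :: "real \<Rightarrow> real" and r :: real and U :: "(real^3) set"
  assumes "open I" and "is_interval I" and "I \<noteq> {}"
    and "timelike_frenet_curve I \<beta> F k1 k2 k3"
    and "r > 0"
    and "open U" and "connected U" and "(\<lambda>p. p$1) ` U = I"
    and "immersion_on (tube \<beta> F r) U"
  shows "(\<forall>p\<in>U. L2_gauss (tube \<beta> F r) (tube_normal F) p = 0) \<longleftrightarrow> (\<forall>s\<in>I. k1 s = 0)"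
proof -
  interpret frenet_tube I \<beta> F k1 k2 k3 r using assms by unfold_locales
  have I: "p$1 \<in> I" and inj: "inj (frechet_derivative (tube \<beta> F r) (at p))" if "p \<in> U" for p
    using that assms unfolding immersion_on_def by auto
  show ?thesis
  proof (intro iffI ballI)
    fix s assume L2: "\<forall>p\<in>U. L2_gauss (tube \<beta> F r) (tube_normal F) p = 0" and "s \<in> I"
    then obtain p where p: "p \<in> U" "p$1 = s" using assms by auto
    \<comment> \<open>\<open>?q t\<close> replaces the second coordinate of p by t and keeps s and
      w; \<open>T\<close> is the corresponding slice of U.\<close>
    let ?q = "\<lambda>t. p + (t - p$2) *\<^sub>R axis 2 1"
    define T where "T = ?q -` U"
    have "open T" unfolding T_def
      by (rule open_vimage) (use assms in \<open>auto intro!: continuous_intros\<close>)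
    moreover have "p$2 \<in> T" using p by (simp add: T_def)
    ultimately have "infinite (cos ` T)" using infinite_cos_image by blast
    have cos: "cos (p$3) \<noteq> 0" by (rule immersion_nondegenerate[OF I inj]) (use p in auto)
    show "k1 s = 0"
    proof (rule ccontr)
      assume k: "k1 s \<noteq> 0"
      define c where "c = - 2 / (3 * r)"
      \<comment> \<open>On the slice \<mu> is cos t times the nonzero constant k1(s) cos w, so its
        two possible values leave two for cos t.\<close>
      have "cos t \<in> {0, c / (k1 s * cos (p$3))}" if "t \<in> T" for t
      proof -
        have q: "?q t \<in> U" using that by (simp add: T_def)
        have "\<mu> (?q t) = k1 s * cos t * cos (p$3)" by (simp add: \<mu>_def axis_def p)
        moreover have "\<mu> (?q t) = 0 \<or> \<mu> (?q t) = c"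
          unfolding c_def using L2_gauss_zero_imp[OF I[OF q] inj[OF q]] L2 q by blast
        ultimately show ?thesis using cos k by (auto simp: eq_divide_eq mult_ac)
      qed
      then have "finite (cos ` T)"
        by (intro finite_subset[of "cos ` T" "{0, c / (k1 s * cos (p$3))}"]) auto
      with \<open>infinite (cos ` T)\<close> show False ..
    qed
  next
    fix p assume k: "\<forall>s\<in>I. k1 s = 0" and p: "p \<in> U"
    let ?H = "mean_curv (tube \<beta> F r) (tube_normal F)"
    have H: "?H 3 q = 0" if "q \<in> U" for q
      using k I[OF that] inj[OF that] by (simp add: mean_curv_tube \<alpha>_def \<mu>_def)
    \<comment> \<open>H_3 is known to vanish only on U, but U is open and differentiation is
      local.\<close>
    have "(?H 3 has_derivative (\<lambda>_. 0)) (at p)"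
      by (rule has_derivative_transform_within_open[of "\<lambda>_. 0" _ _ _ U])
        (use H p assms in auto)
    then show "L2_gauss (tube \<beta> F r) (tube_normal F) p = 0"
      by (simp add: L2_gauss_def Let_def H[OF p] induced_gradient_zero[OF I[OF p] inj[OF p]])
  qed
qed

end
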